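(* Let $R$ be a semilocal ring. Then $R$ is right small dual if and only if $R$ is right dual.
   Context: Rings are associative with identity (not necessarily commutative). For a subset $X\subseteq R$, $\mathbf{l}(X)=\{r\in R: rx=0 \text{ for all } x\in X\}$ and $\mathbf{r}(X)=\{r\in R: xr=0\text{ for all }x\in X\}$. A right ideal $I$ is a right annihilator if $I=\mathbf{r}(X)$ for some $X\subseteq R$, equivalently $\mathbf{r}(\mathbf{l}(I))=I$. A right ideal $I$ is small if $I+K\neq R$ for every proper right ideal $K$ of $R$. $R$ is right dual (resp. right small dual) if every right ideal (resp. every small right ideal) of $R$ is a right annihilator. $R$ is semilocal if $R/J$ is semisimple artinian, where $J$ is the Jacobson radical. *)

theory Defs
  imports "HOL-Algebra.QuotRing"
begin

text \<open>
  Rings are those of the locale \<open>ring\<close>: associative, with identity, not necessarily commutative,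
  and the zero ring is allowed.
\<close>

definition right_ideal :: "'a set \<Rightarrow> ('a, 'b) ring_scheme \<Rightarrow> bool" where
  "right_ideal I R \<longleftrightarrow>
     additive_subgroup I R \<and> (\<forall>a\<in>I. \<forall>x\<in>carrier R. a \<otimes>\<^bsub>R\<^esub> x \<in> I)"

definition right_annihilator_of :: "('a, 'b) ring_scheme \<Rightarrow> 'a set \<Rightarrow> 'a set" where
  "right_annihilator_of R S = {r \<in> carrier R. \<forall>x\<in>S. x \<otimes>\<^bsub>R\<^esub> r = \<zero>\<^bsub>R\<^esub>}"

definition is_right_annihilator :: "'a set \<Rightarrow> ('a, 'b) ring_scheme \<Rightarrow> bool" where
  "is_right_annihilator I R \<longleftrightarrow> (\<exists>S\<subseteq>carrier R. I = right_annihilator_of R S)"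

definition small_right_ideal :: "'a set \<Rightarrow> ('a, 'b) ring_scheme \<Rightarrow> bool" where
  "small_right_ideal I R \<longleftrightarrow>
     right_ideal I R \<and>
     (\<forall>K. right_ideal K R \<and> K \<noteq> carrier R \<longrightarrow> I <+>\<^bsub>R\<^esub> K \<noteq> carrier R)"

definition right_dual :: "('a, 'b) ring_scheme \<Rightarrow> bool" where
  "right_dual R \<longleftrightarrow> (\<forall>I. right_ideal I R \<longrightarrow> is_right_annihilator I R)"

definition right_small_dual :: "('a, 'b) ring_scheme \<Rightarrow> bool" where
  "right_small_dual R \<longleftrightarrow> (\<forall>I. small_right_ideal I R \<longrightarrow> is_right_annihilator I R)"

definition maximal_right_ideal :: "'a set \<Rightarrow> ('a, 'b) ring_scheme \<Rightarrow> bool" where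
  "maximal_right_ideal M R \<longleftrightarrow>
     right_ideal M R \<and> M \<noteq> carrier R \<and>
     (\<forall>K. right_ideal K R \<and> M \<subseteq> K \<longrightarrow> K = M \<or> K = carrier R)"

text \<open>
  The intersection of all maximal right ideals, taken inside the carrier, so that it is the
  whole ring when there are none, that is, for the zero ring.
\<close>

definition jacobson_radical :: "('a, 'b) ring_scheme \<Rightarrow> 'a set" where
  "jacobson_radical R = {x \<in> carrier R. \<forall>M. maximal_right_ideal M R \<longrightarrow> x \<in> M}"

text \<open>Semisimplicity of \<open>R\<close> as a right module over itself: every submodule is a direct summand.\<close>

definition semisimple_ring :: "('a, 'b) ring_scheme \<Rightarrow> bool" where
  "semisimple_ring R \<longleftrightarrow>
     (\<forall>I. right_ideal I R \<longrightarrow>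
        (\<exists>K. right_ideal K R \<and> I <+>\<^bsub>R\<^esub> K = carrier R \<and> I \<inter> K = {\<zero>\<^bsub>R\<^esub>}))"

definition right_artinian :: "('a, 'b) ring_scheme \<Rightarrow> bool" where
  "right_artinian R \<longleftrightarrow>
     (\<forall>I :: nat \<Rightarrow> 'a set.
        (\<forall>n. right_ideal (I n) R) \<and> (\<forall>n. I (Suc n) \<subseteq> I n) \<longrightarrow>
        (\<exists>N. \<forall>n\<ge>N. I n = I N))"

text \<open>
  By Artin-Wedderburn, the one-sided choices made in \<open>semisimple_ring\<close> and \<open>right_artinian\<close>
  are immaterial here, and semisimplicity already implies the chain condition.
\<close>

definition semilocal_ring :: "('a, 'b) ring_scheme \<Rightarrow> bool" where
  "semilocal_ring R \<longleftrightarrow>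
     semisimple_ring (R Quot jacobson_radical R) \<and> right_artinian (R Quot jacobson_radical R)"

end

theory Submission
  imports Defs
begin

text \<open>
  Since \<open>R/J\<close> is semisimple, every right ideal \<open>I\<close> contains some \<open>e\<close> with
  \<open>(1 - e) I \<subseteq> I \<inter> J\<close>. The right ideal \<open>I \<inter> J\<close> is small, hence the right annihilator of a set
  \<open>A\<close>. If \<open>x\<close> is killed by every left annihilator of \<open>I\<close>, then in particular
  \<open>a (1 - e) x = 0\<close> for all \<open>a \<in> A\<close>, so \<open>(1 - e) x \<in> I \<inter> J\<close> and \<open>x = e x + (1 - e) x \<in> I\<close>.
\<close>

context ring
begin

section \<open>Right ideals and their closure properties\<close>

lemma right_idealI:
  assumes "I \<subseteq> carrier R" "\<zero> \<in> I"
    and "\<And>x y. x \<in> I \<Longrightarrow> y \<in> I \<Longrightarrow> x \<oplus> y \<in> I"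
    and mult: "\<And>x r. x \<in> I \<Longrightarrow> r \<in> carrier R \<Longrightarrow> x \<otimes> r \<in> I"
  shows "right_ideal I R"
proof -
  \<comment> \<open>Negatives are right multiples by -1, so closure under right multiplication
    already yields a subgroup.\<close>
  have "\<ominus> x \<in> I" if "x \<in> I" for x
    using mult[OF that, of "\<ominus> \<one>"] that assms(1) by (auto simp: r_minus)
  then have "subgroup I (add_monoid R)"
    using assms(1-3) by (intro subgroup.intro) (auto simp: a_inv_def)
  with mult show ?thesis
    by (auto simp: right_ideal_def intro: additive_subgroupI)
qed

lemma right_idealD:
  assumes "right_ideal I R"
  shows "I \<subseteq> carrier R" "\<zero> \<in> I"
    and "x \<in> I \<Longrightarrow> y \<in> I \<Longrightarrow> x \<oplus> y \<in> I"
    and "x \<in> I \<Longrightarrow> \<ominus> x \<in> I"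
    and "x \<in> I \<Longrightarrow> y \<in> I \<Longrightarrow> x \<ominus> y \<in> I"
    and "x \<in> I \<Longrightarrow> r \<in> carrier R \<Longrightarrow> x \<otimes> r \<in> I"
proof -
  interpret additive_subgroup I R
    using assms by (simp add: right_ideal_def)
  show "I \<subseteq> carrier R" "\<zero> \<in> I" "x \<in> I \<Longrightarrow> y \<in> I \<Longrightarrow> x \<oplus> y \<in> I"
    by (auto simp: a_subset)
  show minus: "z \<in> I \<Longrightarrow> \<ominus> z \<in> I" for z
    using a_subgroup by (metis a_inv_def subgroup.m_inv_closed)
  show "x \<in> I \<Longrightarrow> y \<in> I \<Longrightarrow> x \<ominus> y \<in> I"
    using minus by (simp add: minus_eq)
  show "x \<in> I \<Longrightarrow> r \<in> carrier R \<Longrightarrow> x \<otimes> r \<in> I"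
    using assms by (simp add: right_ideal_def)
qed

lemma right_ideal_inter:
  assumes "right_ideal I R" "right_ideal K R"
  shows "right_ideal (I \<inter> K) R"
  using right_idealD[OF assms(1)] right_idealD[OF assms(2)]
  by (intro right_idealI) auto

lemma right_ideal_eq_carrier:
  assumes "right_ideal I R" "\<one> \<in> I"
  shows "I = carrier R"
  using right_idealD(1,6)[OF assms(1)] assms(2) by force

section \<open>Existence of maximal right ideals\<close>

lemma right_ideal_Union_chain:
  assumes "subset.chain {I. right_ideal I R} C" "C \<noteq> {}"
  shows "right_ideal (\<Union>C) R"
proof (rule right_idealI)
  have C: "right_ideal I R" if "I \<in> C" for I
    using assms(1) that by (auto simp: subset.chain_def)
  show "\<Union>C \<subseteq> carrier R"
    using right_idealD(1)[OF C] by blast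
  show "\<zero> \<in> \<Union>C"
    using right_idealD(2)[OF C] assms(2) by blast
  show "x \<otimes> r \<in> \<Union>C" if "x \<in> \<Union>C" "r \<in> carrier R" for x r
    using right_idealD(6)[OF C] that by blast
  show "x \<oplus> y \<in> \<Union>C" if xy: "x \<in> \<Union>C" "y \<in> \<Union>C" for x y
  proof -
    obtain I K where IK: "I \<in> C" "K \<in> C" "x \<in> I" "y \<in> K"
      using xy by blast
    then consider "I \<subseteq> K" | "K \<subseteq> I"
      using assms(1) by (auto simp: subset_chain_def)
    then show ?thesis
      using IK right_idealD(3)[OF C] by cases blast+
  qed
qed

lemma maximal_right_ideal_exists:
  assumes K: "right_ideal K R" "K \<noteq> carrier R"
  obtains M where "maximal_right_ideal M R" "K \<subseteq> M"
proof -
  let ?A = "{I. right_ideal I R \<and> K \<subseteq> I \<and> I \<noteq> carrier R}"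
  have "\<exists>M\<in>?A. \<forall>X\<in>?A. M \<subseteq> X \<longrightarrow> X = M"
  proof (rule subset_Zorn_nonempty)
    show "?A \<noteq> {}"
      using K by blast
    fix C assume C: "C \<noteq> {}" "subset.chain ?A C"
    then have "right_ideal (\<Union>C) R"
      by (intro right_ideal_Union_chain) (auto simp: subset.chain_def)
    moreover have "K \<subseteq> \<Union>C"
      using C by (fastforce simp: subset.chain_def)
    \<comment> \<open>Properness survives unions of chains because it is detected by the single
      element 1: a right ideal containing 1 is the whole ring.\<close>
    moreover have "\<one> \<notin> \<Union>C"
      using C right_ideal_eq_carrier by (fastforce simp: subset.chain_def)
    ultimately show "\<Union>C \<in> ?A"
      by auto
  qed
  then obtain M where M: "M \<in> ?A" "\<forall>X\<in>?A. M \<subseteq> X \<longrightarrow> X = M"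
    by (rule bexE)
  then have "K \<subseteq> M"
    by simp
  \<comment> \<open>Zorn gives maximality only among the proper right ideals above \<open>K\<close>.
    A right ideal above \<open>M\<close> is also above \<open>K\<close>, so \<open>M\<close> is
    maximal among all proper right ideals.\<close>
  have "X = M \<or> X = carrier R" if X: "right_ideal X R" "M \<subseteq> X" for X
  proof (rule disjCI)
    assume "X \<noteq> carrier R"
    with X \<open>K \<subseteq> M\<close> have "X \<in> ?A"
      by simp
    with M(2) X(2) show "X = M"
      by simp
  qed
  with M(1) have "maximal_right_ideal M R"
    by (simp add: maximal_right_ideal_def)
  then show thesis
    using \<open>K \<subseteq> M\<close> by (rule that)
qed

section \<open>The Jacobson radical as a two-sided ideal\<close>

lemma right_ideal_add_cyclic:
  assumes "right_ideal I R" "a \<in> carrier R"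
  shows "right_ideal {m \<oplus> a \<otimes> t | m t. m \<in> I \<and> t \<in> carrier R} R" (is "right_ideal ?K R")
proof (rule right_idealI)
  note I = right_idealD[OF assms(1)]
  show "?K \<subseteq> carrier R"
    using I(1) assms(2) by auto
  show "\<zero> \<in> ?K"
    using I(2) assms(2) by (intro CollectI exI[of _ \<zero>]) simp
  fix x assume "x \<in> ?K"
  then obtain m t where x: "x = m \<oplus> a \<otimes> t" "m \<in> I" "t \<in> carrier R"
    by blast
  note m = subsetD[OF I(1) x(2)]
  show "x \<otimes> r \<in> ?K" if "r \<in> carrier R" for r
  proof -
    have "x \<otimes> r = m \<otimes> r \<oplus> a \<otimes> (t \<otimes> r)"
      using x m that assms(2) by (simp add: l_distr m_assoc)
    then show ?thesis
      using I(6)[OF x(2) that] x that by blast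
  qed
  fix y assume "y \<in> ?K"
  then obtain n s where y: "y = n \<oplus> a \<otimes> s" "n \<in> I" "s \<in> carrier R"
    by blast
  note n = subsetD[OF I(1) y(2)]
  have "x \<oplus> y = (m \<oplus> n) \<oplus> a \<otimes> (t \<oplus> s)"
    using x y m n assms(2) by (simp add: r_distr a_ac)
  then show "x \<oplus> y \<in> ?K"
    using I(3)[OF x(2) y(2)] x y by blast
qed

text \<open>The right ideal M + aR contains \<open>M\<close> and also \<open>a\<close>, which lies
  outside \<open>M\<close>; maximality forces it to be all of \<open>R\<close>.\<close>

lemma maximal_right_ideal_decomp:
  assumes M: "maximal_right_ideal M R" and a: "a \<in> carrier R" "a \<notin> M"
    and z: "z \<in> carrier R"
  obtains m t where "m \<in> M" "t \<in> carrier R" "z = m \<oplus> a \<otimes> t"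
proof -
  let ?K = "{m \<oplus> a \<otimes> t | m t. m \<in> M \<and> t \<in> carrier R}"
  have I: "right_ideal M R"
    using M by (simp add: maximal_right_ideal_def)
  have "m \<in> ?K" if "m \<in> M" for m
    using that right_idealD(1)[OF I] a by (intro CollectI exI[of _ m] exI[of _ \<zero>]) auto
  moreover have "a \<in> ?K"
    using right_idealD(2)[OF I] a by (intro CollectI exI[of _ \<zero>] exI[of _ \<one>]) auto
  ultimately have "?K = carrier R"
    using M right_ideal_add_cyclic[OF I a(1)] a(2)
    unfolding maximal_right_ideal_def by blast
  then show thesis
    using z that by blast
qed

lemma right_ideal_jacobson_radical: "right_ideal (jacobson_radical R) R"
  by (rule right_idealI)
     (auto simp: jacobson_radical_def maximal_right_ideal_def intro: right_idealD)

text \<open>The set is the kernel of the module map from \<open>R\<close> to the simple module R/M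
  that sends 1 to the nonzero class of \<open>r\<close>. This map is onto, so the quotient of
  \<open>R\<close> by its kernel is simple as well. The result is what lets the radical absorb
  multiplication from the left.\<close>

lemma maximal_right_ideal_quotient:
  assumes M: "maximal_right_ideal M R" and r: "r \<in> carrier R" "r \<notin> M"
  shows "maximal_right_ideal {y \<in> carrier R. r \<otimes> y \<in> M} R" (is "maximal_right_ideal ?N R")
  unfolding maximal_right_ideal_def
proof (intro conjI allI impI)
  have I: "right_ideal M R"
    using M by (simp add: maximal_right_ideal_def)
  note MD = right_idealD[OF I]
  show "right_ideal ?N R"
  proof (rule right_idealI)
    show "x \<otimes> s \<in> ?N" if "x \<in> ?N" "s \<in> carrier R" for x s
      using that r MD(6)[of "r \<otimes> x" s] by (simp add: m_assoc)
  qed (use r MD in \<open>auto simp: r_distr\<close>)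
  show "?N \<noteq> carrier R"
    using r by (metis (mono_tags, lifting) mem_Collect_eq one_closed r_one)
  fix K assume K: "right_ideal K R \<and> ?N \<subseteq> K"
  note KD = right_idealD[OF conjunct1[OF K]]
  show "K = ?N \<or> K = carrier R"
  proof (rule disjCI)
    assume "K \<noteq> carrier R"
    have "r \<otimes> y \<in> M" if y: "y \<in> K" for y
    proof (rule ccontr)
      assume ry: "r \<otimes> y \<notin> M"
      have yc: "y \<in> carrier R"
        using y KD(1) by blast
      \<comment> \<open>Since ry generates R/M, the class of \<open>r\<close> is a multiple of it.
        Then r(1 - yt) = m lies in \<open>M\<close>, which puts 1 - yt into \<open>?N\<close> and
        hence into \<open>K\<close>; as yt is in \<open>K\<close> too, so is 1.\<close>
      obtain m t where mt: "m \<in> M" "t \<in> carrier R" "r = m \<oplus> r \<otimes> y \<otimes> t"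
        using maximal_right_ideal_decomp[OF M _ ry r(1)] r yc by blast
      have mc: "m \<in> carrier R"
        using mt MD(1) by blast
      have "r \<otimes> (\<one> \<ominus> y \<otimes> t) = r \<ominus> r \<otimes> y \<otimes> t"
        using r yc mt(2) by (simp add: minus_eq r_distr r_minus m_assoc)
      also have "\<dots> = m"
        using mt(2) mc r yc
        by (subst mt(3)) (simp add: minus_eq a_assoc r_neg)
      finally have "\<one> \<ominus> y \<otimes> t \<in> K"
        using K mt yc by auto
      then have "\<one> \<ominus> y \<otimes> t \<oplus> y \<otimes> t \<in> K"
        using KD(3,6) y mt(2) by blast
      then have "\<one> \<in> K"
        using yc mt(2) by (simp add: minus_eq a_assoc l_neg)
      then show False
        using right_ideal_eq_carrier K \<open>K \<noteq> carrier R\<close> by blast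
    qed
    then show "K = ?N"
      using K KD(1) by blast
  qed
qed

lemma ideal_jacobson_radical: "ideal (jacobson_radical R) R"
proof (rule idealI)
  let ?J = "jacobson_radical R"
  show "ring R"
    by (rule ring_axioms)
  show "subgroup ?J (add_monoid R)"
    using right_ideal_jacobson_radical
    by (simp add: right_ideal_def additive_subgroup.a_subgroup)
  fix a x assume a: "a \<in> ?J" and x: "x \<in> carrier R"
  show "a \<otimes> x \<in> ?J"
    using right_idealD(6)[OF right_ideal_jacobson_radical a x] .
  have ac: "a \<in> carrier R"
    using a by (simp add: jacobson_radical_def)
  \<comment> \<open>Absorption from the left is the side not built into the definition. If
    \<open>x\<close> is outside \<open>M\<close>, the elements that \<open>x\<close> multiplies into
    \<open>M\<close> form a maximal right ideal, and this one must contain \<open>a\<close>.\<close>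
  have "x \<otimes> a \<in> M" if M: "maximal_right_ideal M R" for M
  proof (cases "x \<in> M")
    case True
    then show ?thesis
      using M ac by (auto simp: maximal_right_ideal_def intro: right_idealD)
  next
    case False
    then have "a \<in> {y \<in> carrier R. x \<otimes> y \<in> M}"
      using a maximal_right_ideal_quotient[OF M x] by (auto simp: jacobson_radical_def)
    then show ?thesis
      by simp
  qed
  then show "x \<otimes> a \<in> ?J"
    using x ac by (simp add: jacobson_radical_def)
qed

section \<open>Small right ideals inside the radical\<close>

lemma small_right_ideal_if_subset_jacobson_radical:
  assumes I: "right_ideal I R" "I \<subseteq> jacobson_radical R"
  shows "small_right_ideal I R"
  unfolding small_right_ideal_def
proof (intro conjI allI impI notI)
  fix K assume K: "right_ideal K R \<and> K \<noteq> carrier R" "I <+> K = carrier R"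
  \<comment> \<open>A maximal right ideal above \<open>K\<close> also contains the radical and hence
    \<open>I\<close>, so it traps the sum of \<open>I\<close> and \<open>K\<close>.\<close>
  then obtain M where M: "maximal_right_ideal M R" "K \<subseteq> M"
    using maximal_right_ideal_exists by blast
  then have "I \<subseteq> M" "right_ideal M R"
    using I(2) by (auto simp: jacobson_radical_def maximal_right_ideal_def)
  then have "I <+> K \<subseteq> M"
    using M(2) right_idealD(3) by (fastforce simp: set_add_def')
  then show False
    using K(2) M(1) right_idealD(1) by (auto simp: maximal_right_ideal_def)
qed (rule I(1))

end

section \<open>A left identity modulo the kernel, lifted from a semisimple image\<close>

lemma (in ring_hom_ring) semisimple_image_left_identity:
  assumes ss: "semisimple_ring S" and surj: "carrier S \<subseteq> h ` carrier R"
    and I: "right_ideal I R"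
  shows "\<exists>e\<in>I. \<forall>y\<in>I. (\<one> \<ominus> e) \<otimes> y \<in> I \<inter> a_kernel R S h"
proof -
  note ID = R.right_idealD[OF I]
  \<comment> \<open>Surjectivity enters here: every multiplier from \<open>S\<close> is the image of
    one from \<open>R\<close>.\<close>
  have "right_ideal (h ` I) S"
  proof (rule S.right_idealI)
    show "h ` I \<subseteq> carrier S"
      using ID(1) by auto
    show "\<zero>\<^bsub>S\<^esub> \<in> h ` I"
      using ID(2) hom_zero by (metis imageI)
    fix x assume "x \<in> h ` I"
    then obtain a where a: "a \<in> I" "a \<in> carrier R" "x = h a"
      using ID(1) by blast
    show "x \<oplus>\<^bsub>S\<^esub> y \<in> h ` I" if "y \<in> h ` I" for y
    proof -
      obtain b where "b \<in> I" "b \<in> carrier R" "y = h b"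
        using \<open>y \<in> h ` I\<close> ID(1) by blast
      then show ?thesis
        using a ID(3)[of a b] by (metis hom_add imageI)
    qed
    show "x \<otimes>\<^bsub>S\<^esub> y \<in> h ` I" if y: "y \<in> carrier S" for y
    proof -
      obtain b where "b \<in> carrier R" "y = h b"
        using y surj by blast
      then show ?thesis
        using a ID(6)[of a b] by (metis hom_mult imageI)
    qed
  qed
  then obtain K where K: "right_ideal K S" "h ` I <+>\<^bsub>S\<^esub> K = carrier S"
      "h ` I \<inter> K = {\<zero>\<^bsub>S\<^esub>}"
    using ss unfolding semisimple_ring_def by blast
  note KD = S.right_idealD[OF K(1)]
  \<comment> \<open>Splitting 1 along the complement \<open>K\<close> produces \<open>e\<close>: its
    image is the component of 1 in the image of \<open>I\<close>, and 1 - e maps to the component in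
    \<open>K\<close>.\<close>
  have "\<one>\<^bsub>S\<^esub> \<in> h ` I <+>\<^bsub>S\<^esub> K"
    using K(2) by simp
  then obtain e k where e: "e \<in> I" "e \<in> carrier R" and k: "k \<in> K" "k \<in> carrier S"
      and one: "\<one>\<^bsub>S\<^esub> = h e \<oplus>\<^bsub>S\<^esub> k"
    using ID(1) KD(1) unfolding set_add_def' by blast
  have "h (\<one> \<ominus> e) = \<one>\<^bsub>S\<^esub> \<ominus>\<^bsub>S\<^esub> h e"
    using e(2) by (simp add: R.minus_eq S.minus_eq)
  also have "\<dots> = k"
    unfolding one using e(2) k(2) by (simp add: S.minus_eq S.a_ac S.r_neg)
  finally have he: "h (\<one> \<ominus> e) \<in> K"
    using k(1) by simp
  show ?thesis
  proof (intro bexI ballI)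
    show "e \<in> I" by (rule e)
    fix y assume y: "y \<in> I"
    have yc: "y \<in> carrier R"
      using y ID(1) by blast
    have "(\<one> \<ominus> e) \<otimes> y = y \<ominus> e \<otimes> y"
      using e(2) yc by (simp add: R.minus_eq R.l_distr R.l_minus)
    then have in_I: "(\<one> \<ominus> e) \<otimes> y \<in> I"
      using ID(5,6) e(1) y yc by simp
    \<comment> \<open>The image of (1 - e)y lies in \<open>K\<close> because that of 1 - e does, and
      in the image of \<open>I\<close> because (1 - e)y = y - ey is in \<open>I\<close>. The two
      meet only in zero.\<close>
    have "h ((\<one> \<ominus> e) \<otimes> y) = h (\<one> \<ominus> e) \<otimes>\<^bsub>S\<^esub> h y"
      using e(2) yc by (intro hom_mult) auto
    also have "\<dots> \<in> K"
      using KD(6)[OF he] yc by simp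
    finally have "h ((\<one> \<ominus> e) \<otimes> y) \<in> h ` I \<inter> K"
      using in_I by (intro IntI imageI)
    then have "h ((\<one> \<ominus> e) \<otimes> y) = \<zero>\<^bsub>S\<^esub>"
      unfolding K(3) by (rule singletonD)
    then show "(\<one> \<ominus> e) \<otimes> y \<in> I \<inter> a_kernel R S h"
      using in_I subsetD[OF ID(1) in_I] unfolding a_kernel_def' by simp
  qed
qed

context ring
begin

text \<open>This is the preceding lemma for the canonical projection \<open>(+>) J\<close>, which is
  onto and has its kernel inside \<open>J\<close>.\<close>

lemma semisimple_quotient_left_identity:
  assumes J: "ideal J R" and ss: "semisimple_ring (R Quot J)" and I: "right_ideal I R"
  shows "\<exists>e\<in>I. \<forall>y\<in>I. (\<one> \<ominus> e) \<otimes> y \<in> I \<inter> J"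
proof -
  have surj: "carrier (R Quot J) \<subseteq> (+>) J ` carrier R"
    by (simp only: FactRing_def A_RCOSETS_def' partial_object.simps) blast
  have abelian_subgroup_J: "abelian_subgroup J R"
    by (intro abelian_subgroupI3 ideal.axioms(1)[OF J] abelian_group_axioms)
  \<comment> \<open>The zero of \<open>R Quot J\<close> is the coset \<open>J\<close> itself, and
    every \<open>x\<close> belongs to its own coset \<open>J +> x\<close>.\<close>
  have "a_kernel R (R Quot J) ((+>) J) = {x \<in> carrier R. J +> x = J}"
    unfolding a_kernel_def' by (simp only: FactRing_def ring.simps)
  also have "\<dots> \<subseteq> J"
    using abelian_subgroup.a_rcos_self[OF abelian_subgroup_J] by auto
  finally have sub: "I \<inter> a_kernel R (R Quot J) ((+>) J) \<subseteq> I \<inter> J"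
    by (intro Int_mono subset_refl)
  obtain e where e: "e \<in> I"
      and eI: "\<forall>y\<in>I. (\<one> \<ominus> e) \<otimes> y \<in> I \<inter> a_kernel R (R Quot J) ((+>) J)"
    using ring_hom_ring.semisimple_image_left_identity[OF ideal.rcos_ring_hom_ring[OF J] ss surj I]
    by (rule bexE)
  show ?thesis
  proof (intro bexI ballI)
    show "(\<one> \<ominus> e) \<otimes> y \<in> I \<inter> J" if "y \<in> I" for y
      using subsetD[OF sub bspec[OF eI that]] .
  qed (rule e)
qed

section \<open>From small right ideals to all right ideals\<close>

lemma right_dual_if_right_small_dual:
  assumes sl: "semilocal_ring R" and sd: "right_small_dual R"
  shows "right_dual R"
  unfolding right_dual_def
proof (intro allI impI)
  fix I assume I: "right_ideal I R"
  note ID = right_idealD[OF I]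
  let ?J = "jacobson_radical R"
  \<comment> \<open>The left annihilator of \<open>I\<close>: its right annihilator is the smallest
    one containing \<open>I\<close>, so \<open>?L\<close> is the natural witness.\<close>
  let ?L = "{s \<in> carrier R. \<forall>y\<in>I. s \<otimes> y = \<zero>}"
  have ss: "semisimple_ring (R Quot ?J)"
    using sl by (simp add: semilocal_ring_def)
  obtain e where e: "e \<in> I" and eI: "\<forall>y\<in>I. (\<one> \<ominus> e) \<otimes> y \<in> I \<inter> ?J"
    using semisimple_quotient_left_identity[OF ideal_jacobson_radical ss I] by (rule bexE)
  have ec: "e \<in> carrier R"
    using e ID(1) by blast
  have "small_right_ideal (I \<inter> ?J) R"
    using I right_ideal_jacobson_radical
    by (intro small_right_ideal_if_subset_jacobson_radical right_ideal_inter) auto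
  then obtain A where A: "A \<subseteq> carrier R" "I \<inter> ?J = right_annihilator_of R A"
    using sd by (auto simp: right_small_dual_def is_right_annihilator_def)
  have "x \<in> I" if x: "x \<in> right_annihilator_of R ?L" for x
  proof -
    have xc: "x \<in> carrier R"
      using x by (simp add: right_annihilator_of_def)
    have "a \<otimes> ((\<one> \<ominus> e) \<otimes> x) = \<zero>" if a: "a \<in> A" for a
    proof -
      have ac: "a \<in> carrier R"
        using a A(1) by blast
      \<comment> \<open>For \<open>y\<close> in \<open>I\<close>, the element (1 - e)y is in the
        right annihilator of \<open>A\<close>. Thus a(1 - e) is a left annihilator of
        \<open>I\<close>, and the hypothesis on \<open>x\<close> applies to it.\<close>
      have "a \<otimes> (\<one> \<ominus> e) \<otimes> y = \<zero>" if "y \<in> I" for y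
        using bspec[OF eI that] a A(2) ac ec that ID(1)
        by (auto simp: right_annihilator_of_def m_assoc)
      then have "a \<otimes> (\<one> \<ominus> e) \<in> ?L"
        using ac ec by simp
      then have "a \<otimes> (\<one> \<ominus> e) \<otimes> x = \<zero>"
        using x unfolding right_annihilator_of_def by blast
      then show ?thesis
        using ac ec xc by (simp add: m_assoc)
    qed
    then have "(\<one> \<ominus> e) \<otimes> x \<in> I \<inter> ?J"
      using A(2) ec xc by (simp add: right_annihilator_of_def)
    then have "e \<otimes> x \<oplus> (\<one> \<ominus> e) \<otimes> x \<in> I"
      using ID(3,6) e xc by blast
    moreover have "e \<otimes> x \<oplus> (\<one> \<ominus> e) \<otimes> x = x"
      using ec xc by (simp add: minus_eq l_distr l_minus a_lcomm[of "e \<otimes> x"] r_neg)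
    ultimately show ?thesis
      by simp
  qed
  then have "right_annihilator_of R ?L \<subseteq> I"
    by (rule subsetI)
  moreover have "I \<subseteq> right_annihilator_of R ?L"
    using ID(1) by (auto simp: right_annihilator_of_def)
  ultimately have "I = right_annihilator_of R ?L"
    by (intro equalityI)
  then show "is_right_annihilator I R"
    unfolding is_right_annihilator_def by (intro exI[of _ ?L]) simp
qed

end

theorem theorem2p12:
  fixes R :: "('a, 'b) ring_scheme"
  assumes "ring R"
    and "semilocal_ring R"
  shows "right_small_dual R \<longleftrightarrow> right_dual R"
  \<comment> \<open>From right to left, small right ideals are in particular right ideals.\<close>
  using ring.right_dual_if_right_small_dual[OF assms]
  by (auto simp: right_dual_def right_small_dual_def small_right_ideal_def)

end
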